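(* Let $\mathbf X^{m-1},\mathbf X^m,\mathbf X^{m+1}\in[V^h]^2$ represent closed polygonal curves with enclosed areas $A^{m-1},A^m,A^{m+1}$. Then $$ \begin{aligned} A^{m+1}-A^{m-1}={}&\frac16\int_{\mathbb I}\left[-\mathbf X^{m+1}+4\mathbf X^m-3\mathbf X^{m-1}\right]\cdot\left[-\partial_\rho\mathbf X^{m-1}\right]^\perp d\rho\\ &+\frac46\int_{\mathbb I}\left[\mathbf X^{m+1}-\mathbf X^{m-1}\right]\cdot\left[-\partial_\rho\mathbf X^{m}\right]^\perp d\rho\\ &+\frac16\int_{\mathbb I}\left[3\mathbf X^{m+1}-4\mathbf X^m+\mathbf X^{m-1}\right]\cdot\left[-\partial_\rho\mathbf X^{m+1}\right]^\perp d\rho . \end{aligned} $$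
   Context: Let $\mathbb I=\mathbb R/\mathbb Z$, $\rho_j=j/N$ for $0\le j\le N$, $h=1/N$, and $V^h=\{u\in C(\mathbb I): u|_{[\rho_{j-1},\rho_j]}\in\mathbb P_1\ (1\le j\le N),\ u(0)=u(1)\}$. A map $\mathbf Z\in[V^h]^2$ represents the closed polygonal curve $\mathbf Z(\mathbb I)\subset\mathbb R^2$. The rotation is $(a,b)^\perp=(-b,a)$, and curves are oriented so that $-(\partial_\rho\mathbf Z)^\perp$ points outward (counterclockwise). The enclosed area of the curve represented by $\mathbf X^k$ is $A^k=\frac12\int_{\mathbb I}\mathbf X^k\cdot[-\partial_\rho\mathbf X^k]^\perp d\rho$. *)

theory Defs
  imports "HOL-Analysis.Analysis" "HOL-Computational_Algebra.Polynomial"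
begin

text \<open>
  Functions on the circle \<open>\<real>/\<int>\<close> are represented by 1-periodic functions on the real line;
  in particular \<open>u 0 = u 1\<close> is part of periodicity.
\<close>

definition node :: "nat \<Rightarrow> nat \<Rightarrow> real" where
  "node N j = real j / real N"

definition Vh :: "nat \<Rightarrow> (real \<Rightarrow> real) set" where
  "Vh N = {u. continuous_on UNIV u \<and> (\<forall>\<rho>. u (\<rho> + 1) = u \<rho>) \<and>
     (\<forall>j\<in>{1..N}. \<exists>p :: real poly. degree p \<le> 1 \<and>
        (\<forall>\<rho>\<in>{node N (j - 1)..node N j}. u \<rho> = poly p \<rho>))}"

definition Vh2 :: "nat \<Rightarrow> (real \<Rightarrow> real ^ 2) set" where
  "Vh2 N = {Z. \<forall>i. (\<lambda>\<rho>. Z \<rho> $ i) \<in> Vh N}"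

definition perp :: "real ^ 2 \<Rightarrow> real ^ 2" where
  "perp v = vector [- (v $ 2), v $ 1]"

text \<open>
  The pointwise derivative of a map in \<open>Vh2 N\<close> exists except possibly at the nodes, where
  \<open>vector_derivative\<close> is unspecified; the nodes in \<open>{0..1}\<close> form a finite set, which does not
  affect the integrals. The area is signed: it is positive for counterclockwise curves, for which
  \<open>perp (- vector_derivative Z (at \<rho>))\<close> points outward.
\<close>

definition enclosed_area :: "(real \<Rightarrow> real ^ 2) \<Rightarrow> real" where
  "enclosed_area Z =
     1 / 2 * integral {0..1} (\<lambda>\<rho>. Z \<rho> \<bullet> perp (- vector_derivative Z (at \<rho>)))"

end

theory Submission imports Defs begin

text \<open>
  Consider the pairing \<open>B(X, Y) = \<integral> X \<bullet> perp (- Y')\<close> over one period, for which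
  \<open>B(X, X)\<close> is twice the enclosed area. It is linear in \<open>X\<close>, and it is symmetric:
  in coordinates, \<open>X \<bullet> perp (- Y') - Y \<bullet> perp (- X')\<close> is the derivative of
  \<open>X\<^sub>1 Y\<^sub>2 - X\<^sub>2 Y\<^sub>1\<close>, a periodic function, so its integral vanishes
  (\<open>area_pairing_commute\<close>). Expanding the right-hand side by linearity, the mixed terms cancel in
  pairs \<open>B(X, Y) - B(Y, X)\<close>, and only \<open>(B(Xnext, Xnext) - B(Xprev, Xprev)) / 2\<close> is left, which
  is the difference of the areas.

  The analytic content is that the curves are differentiable only away from the nodes. Inside a
  cell of the partition the derivative is constant, so the integrand is continuous there up to its
  values at the two end points; this gives integrability (\<open>area_integrand_integrable\<close>). The nodes
  form a finite set and the curves are continuous, so the fundamental theorem of calculus applies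
  across them.
\<close>

definition area_pairing :: "(real \<Rightarrow> real ^ 2) \<Rightarrow> (real \<Rightarrow> real ^ 2) \<Rightarrow> real" where
  "area_pairing X Y = integral {0..1} (\<lambda>\<rho>. X \<rho> \<bullet> perp (- vector_derivative Y (at \<rho>)))"

lemma enclosed_area_eq_pairing: "enclosed_area X = 1 / 2 * area_pairing X X"
  by (simp add: enclosed_area_def area_pairing_def)

lemma inner_perp: "v \<bullet> perp (- w) = v $ 1 * w $ 2 - v $ 2 * w $ 1"
  by (simp add: perp_def inner_vec_def sum_2)

lemma Vh2_continuous_on:
  assumes "Z \<in> Vh2 N"
  shows "continuous_on S Z" "continuous_on S (\<lambda>\<rho>. Z \<rho> $ i)"
proof -
  have comp: "continuous_on S (\<lambda>\<rho>. Z \<rho> $ i)" for i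
    using assms by (auto simp: Vh2_def Vh_def intro: continuous_on_subset)
  show "continuous_on S (\<lambda>\<rho>. Z \<rho> $ i)"
    by (rule comp)
  have "continuous_on S (\<lambda>\<rho>. \<chi> i. Z \<rho> $ i)"
    by (intro continuous_on_vec_lambda comp)
  then show "continuous_on S Z"
    by simp
qed

lemma Vh2_periodic:
  assumes "Z \<in> Vh2 N"
  shows "Z 1 = Z 0"
proof (subst vec_eq_iff, intro allI)
  fix i
  have "\<forall>\<rho>. Z (\<rho> + 1) $ i = Z \<rho> $ i"
    using assms by (simp add: Vh2_def Vh_def)
  from spec[OF this, of 0] show "Z 1 $ i = Z 0 $ i"
    by simp
qed

lemma Vh_cell_derivative:
  assumes "u \<in> Vh N" "j \<in> {1..N}"
  shows "\<exists>c. \<forall>\<rho>\<in>{node N (j - 1)<..<node N j}. (u has_real_derivative c) (at \<rho>)"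
proof -
  have "\<exists>p :: real poly. degree p \<le> 1 \<and> (\<forall>\<rho>\<in>{node N (j - 1)..node N j}. u \<rho> = poly p \<rho>)"
    using assms unfolding Vh_def by blast
  then obtain p :: "real poly" where deg: "degree p \<le> 1"
    and p: "\<forall>\<rho>\<in>{node N (j - 1)..node N j}. u \<rho> = poly p \<rho>"
    by blast
  have "degree (pderiv p) = 0"
    using deg by (simp add: degree_pderiv)
  then obtain c where c: "pderiv p = [:c:]"
    by (metis degree_eq_zeroE)
  have "(u has_real_derivative c) (at \<rho>)" if "\<rho> \<in> {node N (j - 1)<..<node N j}" for \<rho>
  proof (rule has_field_derivative_transform_within_open)
    show "(poly p has_real_derivative c) (at \<rho>)"
      using poly_DERIV[of p \<rho>] by (simp add: c)
    show "open {node N (j - 1)<..<node N j}"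
      by simp
  qed (use that p in auto)
  then show ?thesis
    by blast
qed

lemma Vh2_cell_derivative:
  assumes "Z \<in> Vh2 N" "j \<in> {1..N}"
  obtains v where
    "\<And>\<rho>. \<rho> \<in> {node N (j - 1)<..<node N j} \<Longrightarrow> (Z has_vector_derivative v) (at \<rho>)"
proof -
  have "\<forall>i. \<exists>c. \<forall>\<rho>\<in>{node N (j - 1)<..<node N j}.
          ((\<lambda>\<rho>. Z \<rho> $ i) has_real_derivative c) (at \<rho>)"
    using assms unfolding Vh2_def by (blast intro: Vh_cell_derivative)
  then obtain c where c: "\<And>i \<rho>. \<rho> \<in> {node N (j - 1)<..<node N j} \<Longrightarrow>
      ((\<lambda>\<rho>. Z \<rho> $ i) has_real_derivative c i) (at \<rho>)"
    by metis
  have "(Z has_vector_derivative (\<chi> i. c i)) (at \<rho>)"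
    if "\<rho> \<in> {node N (j - 1)<..<node N j}" for \<rho>
    unfolding has_vector_derivative_def
    using c[OF that]
    by (subst has_derivative_componentwise_within)
       (auto simp: Basis_vec_def inner_axis has_field_derivative_def mult_commute_abs)
  then show thesis
    by (rule that)
qed

text \<open>
  The cell containing \<open>\<rho>\<close> is found by rounding \<open>\<rho> N\<close> up.
\<close>

lemma in_cell:
  assumes "N \<ge> 1" "\<rho> \<in> {0..1}" "\<rho> \<notin> node N ` {..N}"
  obtains j where "j \<in> {1..N}" "\<rho> \<in> {node N (j - 1)<..<node N j}"
proof -
  define j where "j = nat \<lceil>\<rho> * N\<rceil>"
  have neq: "\<rho> \<noteq> node N k" if "k \<le> N" for k
    using assms(3) that by auto
  have pos: "\<rho> * N > 0"
    using assms neq[of 0] by (auto simp: node_def)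
  have "\<rho> * N \<le> N"
    using assms by (auto simp: mult_left_le_one_le)
  then have j: "1 \<le> j" "j \<le> N"
    using pos unfolding j_def by linarith+
  have "real (j - 1) < \<rho> * N" "\<rho> * N \<le> real j"
    using pos j unfolding j_def by linarith+
  then have "node N (j - 1) < \<rho>" "\<rho> \<le> node N j"
    using assms(1) by (auto simp: node_def field_simps)
  moreover have "\<rho> \<noteq> node N j"
    using neq j by blast
  ultimately show thesis
    using that j by auto
qed

lemma area_integrand_integrable:
  assumes N: "N \<ge> 1" and X: "continuous_on {0..1} X" and Y: "Y \<in> Vh2 N"
  shows "(\<lambda>\<rho>. X \<rho> \<bullet> perp (- vector_derivative Y (at \<rho>))) integrable_on {0..1}"
    (is "?f integrable_on _")
proof -
  have "?f integrable_on {0..node N k}" if "k \<le> N" for k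
    using that
  proof (induction k)
    case 0
    show ?case
      using integrable_on_refl[of ?f 0] by (simp add: node_def)
  next
    case (Suc k)
    have nodes: "0 \<le> node N k" "node N k \<le> node N (Suc k)" "node N (Suc k) \<le> 1"
      using N Suc.prems by (auto simp: node_def field_simps)
    obtain v where v: "\<And>\<rho>. \<rho> \<in> {node N k<..<node N (Suc k)} \<Longrightarrow>
        (Y has_vector_derivative v) (at \<rho>)"
      using Vh2_cell_derivative[OF Y, of "Suc k"] Suc.prems by auto
    have "(\<lambda>\<rho>. X \<rho> \<bullet> perp (- v)) integrable_on {node N k..node N (Suc k)}"
      using nodes by (intro integrable_continuous_interval continuous_intros
          continuous_on_subset[OF X]) auto
    \<comment> \<open>At the two end points the vector derivative is unspecified.\<close>
    then have "?f integrable_on {node N k..node N (Suc k)}"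
      by (rule integrable_spike_finite[of "{node N k, node N (Suc k)}", rotated 2])
         (auto simp: vector_derivative_at[OF v])
    with Suc nodes show ?case
      by (auto intro: Henstock_Kurzweil_Integration.integrable_combine[of 0 "node N k"])
  qed
  from this[of N] show ?thesis
    using N by (simp add: node_def)
qed

text \<open>
  Integration by parts without boundary terms: the curves are closed.
\<close>

lemma area_pairing_commute:
  assumes N: "N \<ge> 1" and X: "X \<in> Vh2 N" and Y: "Y \<in> Vh2 N"
  shows "area_pairing X Y = area_pairing Y X"
proof -
  define F where "F = (\<lambda>\<rho>. X \<rho> $ 1 * Y \<rho> $ 2 - X \<rho> $ 2 * Y \<rho> $ 1)"
  let ?f = "\<lambda>X Y \<rho>. X \<rho> \<bullet> perp (- vector_derivative Y (at \<rho>))"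
  have "((\<lambda>\<rho>. ?f X Y \<rho> - ?f Y X \<rho>) has_integral F 1 - F 0) {0..1}"
  proof (rule fundamental_theorem_of_calculus_interior_strong[of "node N ` {..N}"])
    show "continuous_on {0..1} F"
      unfolding F_def by (intro continuous_intros Vh2_continuous_on[OF X] Vh2_continuous_on[OF Y])
    fix \<rho> :: real
    assume "\<rho> \<in> {0<..<1} - node N ` {..N}"
    then obtain j where j: "j \<in> {1..N}" "\<rho> \<in> {node N (j - 1)<..<node N j}"
      using in_cell[OF N, of \<rho>] by auto
    obtain v where v: "(X has_vector_derivative v) (at \<rho>)"
      using Vh2_cell_derivative[OF X j(1)] j(2) by metis
    obtain w where w: "(Y has_vector_derivative w) (at \<rho>)"
      using Vh2_cell_derivative[OF Y j(1)] j(2) by metis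
    have comp: "((\<lambda>\<rho>. Z \<rho> $ i) has_vector_derivative z $ i) (at \<rho>)"
      if "(Z has_vector_derivative z) (at \<rho>)" for Z :: "real \<Rightarrow> real ^ 2" and z i
      by (rule bounded_linear.has_vector_derivative[OF bounded_linear_vec_nth that])
    have "(F has_vector_derivative
        (X \<rho> $ 1 * w $ 2 + v $ 1 * Y \<rho> $ 2) - (X \<rho> $ 2 * w $ 1 + v $ 2 * Y \<rho> $ 1)) (at \<rho>)"
      unfolding F_def
      by (intro has_vector_derivative_diff has_vector_derivative_mult comp v w)
    then show "(F has_vector_derivative ?f X Y \<rho> - ?f Y X \<rho>) (at \<rho>)"
      by (simp add: vector_derivative_at[OF v] vector_derivative_at[OF w] inner_perp algebra_simps)
  qed auto
  moreover have "F 1 = F 0"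
    by (simp add: F_def Vh2_periodic[OF X] Vh2_periodic[OF Y])
  ultimately have "integral {0..1} (\<lambda>\<rho>. ?f X Y \<rho> - ?f Y X \<rho>) = 0"
    by (simp add: integral_unique)
  then show ?thesis
    using area_integrand_integrable[OF N Vh2_continuous_on(1)[OF X] Y]
      area_integrand_integrable[OF N Vh2_continuous_on(1)[OF Y] X]
    by (simp add: area_pairing_def integral_diff)
qed

lemma area_pairing_add_left:
  assumes "N \<ge> 1" "continuous_on {0..1} X" "continuous_on {0..1} X'" "Y \<in> Vh2 N"
  shows "area_pairing (\<lambda>\<rho>. X \<rho> + X' \<rho>) Y = area_pairing X Y + area_pairing X' Y"
  unfolding area_pairing_def inner_add_left
  by (intro integral_add area_integrand_integrable[OF assms(1)] assms)

lemma area_pairing_diff_left: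
  assumes "N \<ge> 1" "continuous_on {0..1} X" "continuous_on {0..1} X'" "Y \<in> Vh2 N"
  shows "area_pairing (\<lambda>\<rho>. X \<rho> - X' \<rho>) Y = area_pairing X Y - area_pairing X' Y"
  unfolding area_pairing_def inner_diff_left
  by (intro integral_diff area_integrand_integrable[OF assms(1)] assms)

lemma area_pairing_scaleR_left: "area_pairing (\<lambda>\<rho>. c *\<^sub>R X \<rho>) Y = c * area_pairing X Y"
  by (simp add: area_pairing_def)

lemma area_pairing_minus_left: "area_pairing (\<lambda>\<rho>. - X \<rho>) Y = - area_pairing X Y"
  using area_pairing_scaleR_left[of "-1"] by simp

theorem mainTheorem3:
  fixes N :: nat and Xprev Xcur Xnext :: "real \<Rightarrow> real ^ 2"
  assumes "N \<ge> 1"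
    and "Xprev \<in> Vh2 N" and "Xcur \<in> Vh2 N" and "Xnext \<in> Vh2 N"
  shows "enclosed_area Xnext - enclosed_area Xprev =
      1 / 6 * integral {0..1} (\<lambda>\<rho>. (- Xnext \<rho> + 4 *\<^sub>R Xcur \<rho> - 3 *\<^sub>R Xprev \<rho>)
                                    \<bullet> perp (- vector_derivative Xprev (at \<rho>)))
    + 4 / 6 * integral {0..1} (\<lambda>\<rho>. (Xnext \<rho> - Xprev \<rho>)
                                    \<bullet> perp (- vector_derivative Xcur (at \<rho>)))
    + 1 / 6 * integral {0..1} (\<lambda>\<rho>. (3 *\<^sub>R Xnext \<rho> - 4 *\<^sub>R Xcur \<rho> + Xprev \<rho>)
                                    \<bullet> perp (- vector_derivative Xnext (at \<rho>)))"
proof -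
  note cont = continuous_intros assms(2-4)[THEN Vh2_continuous_on(1)]
  note linear_left = area_pairing_add_left[OF assms(1)] area_pairing_diff_left[OF assms(1)]
    area_pairing_scaleR_left area_pairing_minus_left
  have "area_pairing (\<lambda>\<rho>. - Xnext \<rho> + 4 *\<^sub>R Xcur \<rho> - 3 *\<^sub>R Xprev \<rho>) Xprev =
      - area_pairing Xnext Xprev + 4 * area_pairing Xcur Xprev - 3 * area_pairing Xprev Xprev"
    by (simp add: linear_left cont assms)
  moreover have "area_pairing (\<lambda>\<rho>. Xnext \<rho> - Xprev \<rho>) Xcur =
      area_pairing Xnext Xcur - area_pairing Xprev Xcur"
    by (simp add: linear_left cont assms)
  moreover have "area_pairing (\<lambda>\<rho>. 3 *\<^sub>R Xnext \<rho> - 4 *\<^sub>R Xcur \<rho> + Xprev \<rho>) Xnext =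
      3 * area_pairing Xnext Xnext - 4 * area_pairing Xcur Xnext + area_pairing Xprev Xnext"
    by (simp add: linear_left cont assms)
  moreover have "area_pairing Xnext Xprev = area_pairing Xprev Xnext"
    "area_pairing Xcur Xprev = area_pairing Xprev Xcur"
    "area_pairing Xnext Xcur = area_pairing Xcur Xnext"
    using assms by (auto intro: area_pairing_commute)
  ultimately show ?thesis
    unfolding enclosed_area_eq_pairing area_pairing_def[symmetric]
    by (simp add: field_simps)
qed

end
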